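(* Let $(\mathscr{A},\mathscr{E})$ be an exact category. Suppose that the diagram $$\begin{array}{ccccccccc} A_1 & \to & A_2 & \to & A_3 & \to & A_4 & \to & A_5\\ \downarrow & & \downarrow & & {\scriptstyle f}\downarrow & & \downarrow & & \downarrow\\ B_1 & \to & B_2 & \to & B_3 & \to & B_4 & \to & B_5\end{array}$$ in $\mathscr{A}$ is commutative, that its rows are exact sequences of admissible morphisms, and that the vertical morphisms $A_i\to B_i$ for $i=1,2,4,5$ are isomorphisms. Then $f:A_3\to B_3$ is an isomorphism.
   Context: A kernel-cokernel pair in an additive category $\mathscr{A}$ is a pair of composable morphisms $A'\xrightarrow{i}A\xrightarrow{p}A''$ such that $i$ is a kernel of $p$ and $p$ is a cokernel of $i$. Given a class $\mathscr{E}$ of kernel-cokernel pairs, an admissible monic is a morphism $i$ for which there is $p$ with $(i,p)\in\mathscr{E}$; an admissible epic is a morphism $p$ for which there is $i$ with $(i,p)\in\mathscr{E}$. An exact structure on $\mathscr{A}$ is a class $\mathscr{E}$ of kernel-cokernel pairs closed under isomorphisms such that: all identity morphisms are admissible monics and admissible epics; admissible monics are closed under composition and admissible epics are closed under composition; the push-out of an admissible monic along an arbitrary morphism exists and yields an admissible monic; the pull-back of an admissible epic along an arbitrary morphism exists and yields an admissible epic. An exact category is a pair $(\mathscr{A},\mathscr{E})$ of an additive category and an exact structure on it; elements of $\mathscr{E}$ are called short exact sequences. A morphism $f$ in an exact category is admissible if it factors as $f=me$ with $e$ an admissible epic and $m$ an admissible monic; this factorization is unique up to unique isomorphism. A sequence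 of admissible morphisms $A'\xrightarrow{f}A\xrightarrow{f'}A''$ with factorizations $f=me$, $m:I\to A$, and $f'=m'e'$, $e':A\to I'$, is exact if $I\xrightarrow{m}A\xrightarrow{e'}I'$ is short exact (in $\mathscr{E}$). Longer sequences of admissible morphisms are exact if any two consecutive morphisms form an exact sequence. *)

theory Defs
  imports "HOL-Algebra.Group"
begin

text \<open>
  Composition is written in applicative order and is meaningful only for composable arrows
  (\<open>Tgt f = Src g\<close> in \<open>g \<cdot> f\<close>); outside its intended domain it is unspecified, so that
  all statements below carry the relevant source and target conditions.
\<close>

record ('o, 'm) precat =
  Obj :: "'o set"
  Arr :: "'m set"
  Src :: "'m \<Rightarrow> 'o"
  Tgt :: "'m \<Rightarrow> 'o"
  Idm :: "'o \<Rightarrow> 'm"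
  Cmp :: "'m \<Rightarrow> 'm \<Rightarrow> 'm"  (infixr \<open>\<cdot>\<index>\<close> 70)

definition Mor :: "('o, 'm, 'e) precat_scheme \<Rightarrow> 'o \<Rightarrow> 'o \<Rightarrow> 'm set" where
  "Mor C a b = {f \<in> Arr C. Src C f = a \<and> Tgt C f = b}"

locale category =
  fixes C (structure)
  assumes Src_in_Obj: "f \<in> Arr C \<Longrightarrow> Src C f \<in> Obj C"
    and Tgt_in_Obj: "f \<in> Arr C \<Longrightarrow> Tgt C f \<in> Obj C"
    and Idm_in_Mor: "a \<in> Obj C \<Longrightarrow> Idm C a \<in> Mor C a a"
    and Cmp_in_Mor: "\<lbrakk>f \<in> Mor C a b; g \<in> Mor C b c\<rbrakk> \<Longrightarrow> g \<cdot> f \<in> Mor C a c"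
    and Cmp_Idm: "f \<in> Mor C a b \<Longrightarrow> f \<cdot> Idm C a = f"
    and Idm_Cmp: "f \<in> Mor C a b \<Longrightarrow> Idm C b \<cdot> f = f"
    and Cmp_assoc: "\<lbrakk>f \<in> Mor C a b; g \<in> Mor C b c; h \<in> Mor C c d\<rbrakk>
      \<Longrightarrow> (h \<cdot> g) \<cdot> f = h \<cdot> (g \<cdot> f)"

definition is_isomorphism :: "('o, 'm, 'e) precat_scheme \<Rightarrow> 'm \<Rightarrow> bool" where
  "is_isomorphism C f \<longleftrightarrow> f \<in> Arr C \<and>
    (\<exists>g \<in> Mor C (Tgt C f) (Src C f).
       g \<cdot>\<^bsub>C\<^esub> f = Idm C (Src C f) \<and> f \<cdot>\<^bsub>C\<^esub> g = Idm C (Tgt C f))"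

definition is_zero_object :: "('o, 'm, 'e) precat_scheme \<Rightarrow> 'o \<Rightarrow> bool" where
  "is_zero_object C z \<longleftrightarrow> z \<in> Obj C \<and>
    (\<forall>a \<in> Obj C. (\<exists>!f. f \<in> Mor C z a) \<and> (\<exists>!f. f \<in> Mor C a z))"

text \<open>
  \<open>is_pushout C i f i' f'\<close>: the square with sides \<open>i : A \<rightarrow> B\<close>, \<open>f : A \<rightarrow> A'\<close>,
  \<open>i' : A' \<rightarrow> B'\<close>, \<open>f' : B \<rightarrow> B'\<close> is a push-out, so \<open>i'\<close> is the push-out of \<open>i\<close> along \<open>f\<close>.
\<close>

definition is_pushout :: "('o, 'm, 'e) precat_scheme \<Rightarrow> 'm \<Rightarrow> 'm \<Rightarrow> 'm \<Rightarrow> 'm \<Rightarrow> bool" where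
  "is_pushout C i f i' f' \<longleftrightarrow>
    (\<exists>A B A' B'. i \<in> Mor C A B \<and> f \<in> Mor C A A' \<and> i' \<in> Mor C A' B' \<and> f' \<in> Mor C B B' \<and>
       f' \<cdot>\<^bsub>C\<^esub> i = i' \<cdot>\<^bsub>C\<^esub> f \<and>
       (\<forall>X. \<forall>u \<in> Mor C B X. \<forall>v \<in> Mor C A' X. u \<cdot>\<^bsub>C\<^esub> i = v \<cdot>\<^bsub>C\<^esub> f \<longrightarrow>
          (\<exists>!w. w \<in> Mor C B' X \<and> w \<cdot>\<^bsub>C\<^esub> f' = u \<and> w \<cdot>\<^bsub>C\<^esub> i' = v)))"

text \<open>
  \<open>is_pullback C p f p' f'\<close>: the square with sides \<open>p : B \<rightarrow> A\<close>, \<open>f : A' \<rightarrow> A\<close>,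
  \<open>p' : B' \<rightarrow> A'\<close>, \<open>f' : B' \<rightarrow> B\<close> is a pull-back, so \<open>p'\<close> is the pull-back of \<open>p\<close> along \<open>f\<close>.
\<close>

definition is_pullback :: "('o, 'm, 'e) precat_scheme \<Rightarrow> 'm \<Rightarrow> 'm \<Rightarrow> 'm \<Rightarrow> 'm \<Rightarrow> bool" where
  "is_pullback C p f p' f' \<longleftrightarrow>
    (\<exists>A B A' B'. p \<in> Mor C B A \<and> f \<in> Mor C A' A \<and> p' \<in> Mor C B' A' \<and> f' \<in> Mor C B' B \<and>
       p \<cdot>\<^bsub>C\<^esub> f' = f \<cdot>\<^bsub>C\<^esub> p' \<and>
       (\<forall>X. \<forall>u \<in> Mor C X B. \<forall>v \<in> Mor C X A'. p \<cdot>\<^bsub>C\<^esub> u = f \<cdot>\<^bsub>C\<^esub> v \<longrightarrow>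
          (\<exists>!w. w \<in> Mor C X B' \<and> f' \<cdot>\<^bsub>C\<^esub> w = u \<and> p' \<cdot>\<^bsub>C\<^esub> w = v)))"

record ('o, 'm) preaddcat = "('o, 'm) precat" +
  Add :: "'m \<Rightarrow> 'm \<Rightarrow> 'm"  (infixl \<open>\<boxplus>\<index>\<close> 65)
  Zero :: "'o \<Rightarrow> 'o \<Rightarrow> 'm"

definition Mor_group :: "('o, 'm, 'e) preaddcat_scheme \<Rightarrow> 'o \<Rightarrow> 'o \<Rightarrow> 'm monoid" where
  "Mor_group C a b = \<lparr>carrier = Mor C a b, monoid.mult = Add C, one = Zero C a b\<rparr>"

locale preadditive_category = category C for C (structure) +
  assumes Mor_comm_group: "\<lbrakk>a \<in> Obj C; b \<in> Obj C\<rbrakk> \<Longrightarrow> comm_group (Mor_group C a b)"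
    and Cmp_Add: "\<lbrakk>f \<in> Mor C a b; g \<in> Mor C a b; h \<in> Mor C b c\<rbrakk>
      \<Longrightarrow> h \<cdot> (f \<boxplus> g) = (h \<cdot> f) \<boxplus> (h \<cdot> g)"
    and Add_Cmp: "\<lbrakk>f \<in> Mor C a b; g \<in> Mor C b c; h \<in> Mor C b c\<rbrakk>
      \<Longrightarrow> (g \<boxplus> h) \<cdot> f = (g \<cdot> f) \<boxplus> (h \<cdot> f)"

definition is_biproduct ::
    "('o, 'm, 'e) preaddcat_scheme \<Rightarrow> 'o \<Rightarrow> 'o \<Rightarrow> 'o \<Rightarrow> 'm \<Rightarrow> 'm \<Rightarrow> 'm \<Rightarrow> 'm \<Rightarrow> bool" where
  "is_biproduct C a b s i\<^sub>a i\<^sub>b p\<^sub>a p\<^sub>b \<longleftrightarrow>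
     i\<^sub>a \<in> Mor C a s \<and> i\<^sub>b \<in> Mor C b s \<and> p\<^sub>a \<in> Mor C s a \<and> p\<^sub>b \<in> Mor C s b \<and>
     p\<^sub>a \<cdot>\<^bsub>C\<^esub> i\<^sub>a = Idm C a \<and> p\<^sub>b \<cdot>\<^bsub>C\<^esub> i\<^sub>b = Idm C b \<and>
     p\<^sub>b \<cdot>\<^bsub>C\<^esub> i\<^sub>a = Zero C a b \<and> p\<^sub>a \<cdot>\<^bsub>C\<^esub> i\<^sub>b = Zero C b a \<and>
     (i\<^sub>a \<cdot>\<^bsub>C\<^esub> p\<^sub>a) \<boxplus>\<^bsub>C\<^esub> (i\<^sub>b \<cdot>\<^bsub>C\<^esub> p\<^sub>b) = Idm C s"

locale additive_category = preadditive_category C for C (structure) +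
  assumes zero_object: "\<exists>z. is_zero_object C z"
    and biproducts: "\<lbrakk>a \<in> Obj C; b \<in> Obj C\<rbrakk>
      \<Longrightarrow> \<exists>s i\<^sub>a i\<^sub>b p\<^sub>a p\<^sub>b. is_biproduct C a b s i\<^sub>a i\<^sub>b p\<^sub>a p\<^sub>b"

definition is_kernel :: "('o, 'm, 'e) preaddcat_scheme \<Rightarrow> 'm \<Rightarrow> 'm \<Rightarrow> bool" where
  "is_kernel C i p \<longleftrightarrow>
    (\<exists>A' A A''. i \<in> Mor C A' A \<and> p \<in> Mor C A A'' \<and> p \<cdot>\<^bsub>C\<^esub> i = Zero C A' A'' \<and>
       (\<forall>X. \<forall>g \<in> Mor C X A. p \<cdot>\<^bsub>C\<^esub> g = Zero C X A'' \<longrightarrow>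
          (\<exists>!h. h \<in> Mor C X A' \<and> i \<cdot>\<^bsub>C\<^esub> h = g)))"

definition is_cokernel :: "('o, 'm, 'e) preaddcat_scheme \<Rightarrow> 'm \<Rightarrow> 'm \<Rightarrow> bool" where
  "is_cokernel C p i \<longleftrightarrow>
    (\<exists>A' A A''. i \<in> Mor C A' A \<and> p \<in> Mor C A A'' \<and> p \<cdot>\<^bsub>C\<^esub> i = Zero C A' A'' \<and>
       (\<forall>X. \<forall>g \<in> Mor C A X. g \<cdot>\<^bsub>C\<^esub> i = Zero C A' X \<longrightarrow>
          (\<exists>!h. h \<in> Mor C A'' X \<and> h \<cdot>\<^bsub>C\<^esub> p = g)))"

definition kernel_cokernel_pair :: "('o, 'm, 'e) preaddcat_scheme \<Rightarrow> 'm \<Rightarrow> 'm \<Rightarrow> bool" where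
  "kernel_cokernel_pair C i p \<longleftrightarrow> is_kernel C i p \<and> is_cokernel C p i"

text \<open>Isomorphism of pairs of composable morphisms, seen as diagrams \<open>A' \<rightarrow> A \<rightarrow> A''\<close>.\<close>

definition iso_pairs ::
    "('o, 'm, 'e) precat_scheme \<Rightarrow> 'm \<Rightarrow> 'm \<Rightarrow> 'm \<Rightarrow> 'm \<Rightarrow> bool" where
  "iso_pairs C i p j q \<longleftrightarrow>
    (\<exists>A' A A'' B' B B'' u' u u''.
       i \<in> Mor C A' A \<and> p \<in> Mor C A A'' \<and> j \<in> Mor C B' B \<and> q \<in> Mor C B B'' \<and>
       u' \<in> Mor C A' B' \<and> u \<in> Mor C A B \<and> u'' \<in> Mor C A'' B'' \<and>
       is_isomorphism C u' \<and> is_isomorphism C u \<and> is_isomorphism C u'' \<and>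
       j \<cdot>\<^bsub>C\<^esub> u' = u \<cdot>\<^bsub>C\<^esub> i \<and> q \<cdot>\<^bsub>C\<^esub> u = u'' \<cdot>\<^bsub>C\<^esub> p)"

definition adm_monic :: "('m \<times> 'm) set \<Rightarrow> 'm \<Rightarrow> bool" where
  "adm_monic E i \<longleftrightarrow> (\<exists>p. (i, p) \<in> E)"

definition adm_epic :: "('m \<times> 'm) set \<Rightarrow> 'm \<Rightarrow> bool" where
  "adm_epic E p \<longleftrightarrow> (\<exists>i. (i, p) \<in> E)"

locale exact_category = additive_category C for C (structure) +
  fixes E :: "('m \<times> 'm) set"
  assumes E_kernel_cokernel: "(i, p) \<in> E \<Longrightarrow> kernel_cokernel_pair C i p"
    and E_iso_closed: "\<lbrakk>(i, p) \<in> E; iso_pairs C i p j q\<rbrakk> \<Longrightarrow> (j, q) \<in> E"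
    and Idm_adm_monic: "a \<in> Obj C \<Longrightarrow> adm_monic E (Idm C a)"
    and Idm_adm_epic: "a \<in> Obj C \<Longrightarrow> adm_epic E (Idm C a)"
    and adm_monic_Cmp: "\<lbrakk>adm_monic E i; adm_monic E j; Tgt C i = Src C j\<rbrakk>
      \<Longrightarrow> adm_monic E (j \<cdot> i)"
    and adm_epic_Cmp: "\<lbrakk>adm_epic E p; adm_epic E q; Tgt C p = Src C q\<rbrakk>
      \<Longrightarrow> adm_epic E (q \<cdot> p)"
    and adm_monic_pushout: "\<lbrakk>adm_monic E i; f \<in> Arr C; Src C f = Src C i\<rbrakk>
      \<Longrightarrow> (\<exists>i' f'. is_pushout C i f i' f') \<and>
          (\<forall>i' f'. is_pushout C i f i' f' \<longrightarrow> adm_monic E i')"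
    and adm_epic_pullback: "\<lbrakk>adm_epic E p; f \<in> Arr C; Tgt C f = Tgt C p\<rbrakk>
      \<Longrightarrow> (\<exists>p' f'. is_pullback C p f p' f') \<and>
          (\<forall>p' f'. is_pullback C p f p' f' \<longrightarrow> adm_epic E p')"

definition adm_factorization ::
    "('o, 'm, 'e) precat_scheme \<Rightarrow> ('m \<times> 'm) set \<Rightarrow> 'm \<Rightarrow> 'm \<Rightarrow> 'm \<Rightarrow> bool" where
  "adm_factorization C E f m e \<longleftrightarrow>
     adm_epic E e \<and> adm_monic E m \<and> Tgt C e = Src C m \<and> f = m \<cdot>\<^bsub>C\<^esub> e"

definition admissible :: "('o, 'm, 'e) precat_scheme \<Rightarrow> ('m \<times> 'm) set \<Rightarrow> 'm \<Rightarrow> bool" where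
  "admissible C E f \<longleftrightarrow> (\<exists>m e. adm_factorization C E f m e)"

text \<open>
  In an exact category the factorization of an admissible morphism is unique up to unique
  isomorphism and \<open>E\<close> is closed under isomorphisms, so the choice of factorizations is immaterial.
\<close>

definition exact_pair :: "('o, 'm, 'e) precat_scheme \<Rightarrow> ('m \<times> 'm) set \<Rightarrow> 'm \<Rightarrow> 'm \<Rightarrow> bool" where
  "exact_pair C E f f' \<longleftrightarrow>
    (\<exists>m e m' e'. adm_factorization C E f m e \<and> adm_factorization C E f' m' e' \<and> (m, e') \<in> E)"

definition exact_sequence :: "('o, 'm, 'e) precat_scheme \<Rightarrow> ('m \<times> 'm) set \<Rightarrow> 'm list \<Rightarrow> bool" where
  "exact_sequence C E fs \<longleftrightarrow> (\<forall>f \<in> set fs. admissible C E f) \<and> successively (exact_pair C E) fs"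

end

theory Submission
  imports Defs
begin

text \<open>
  The proof is a diagram chase with generalised elements: a morphism \<open>x : X \<rightarrow> A\<close> killed by the
  second arrow of an exact pair lifts along the first one after precomposition with an admissible
  epic, and admissible epics can be cancelled on the right. The chase from the left shows
  that \<open>f\<close> is monic; the chase starting at the identity of \<open>B\<^sub>3\<close> shows that some admissible epic
  factors through \<open>f\<close>. As an admissible epic is a cokernel, this forces \<open>f\<close> to be an isomorphism.
\<close>

section \<open>Morphisms with given source and target, and inverses\<close>

lemma MorD: "f \<in> Mor C a b \<Longrightarrow> f \<in> Arr C \<and> Src C f = a \<and> Tgt C f = b"
  by (simp add: Mor_def)

lemma Mor_unique: "\<lbrakk>f \<in> Mor C a b; f \<in> Mor C a' b'\<rbrakk> \<Longrightarrow> a = a' \<and> b = b'"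
  by (auto simp: Mor_def)

context category
begin

lemma Mor_Obj: "f \<in> Mor C a b \<Longrightarrow> a \<in> Obj C \<and> b \<in> Obj C"
  using Src_in_Obj Tgt_in_Obj by (auto simp: Mor_def)

lemma is_isomorphismE:
  assumes "is_isomorphism C f" "f \<in> Mor C a b"
  obtains g where "g \<in> Mor C b a" "g \<cdot> f = Idm C a" "f \<cdot> g = Idm C b"
  using assms by (auto simp: is_isomorphism_def Mor_def)

lemma Cmp_left_inverse:
  assumes "g \<cdot> f = Idm C a" "f \<in> Mor C a b" "g \<in> Mor C b a" "x \<in> Mor C c a"
  shows "g \<cdot> (f \<cdot> x) = x"
  using assms Cmp_assoc[of x c a f b g a] Idm_Cmp by simp

end

section \<open>Arithmetic in the groups of morphisms\<close>

context preadditive_category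
begin

text \<open>The group laws are transported once from \<open>Mor_group\<close>. As
  \<open>preaddcat\<close> has no subtraction, \<open>difference_exists\<close> names a difference
  \<open>u\<close> by the equation \<open>f = u \<boxplus> g\<close>.\<close>

lemma
  assumes f: "f \<in> Mor C a b"
  shows Zero_Add: "Zero C a b \<boxplus> f = f"
    and Add_in_Mor: "g \<in> Mor C a b \<Longrightarrow> f \<boxplus> g \<in> Mor C a b"
    and Add_right_cancel: "\<lbrakk>g \<in> Mor C a b; h \<in> Mor C a b\<rbrakk> \<Longrightarrow> f \<boxplus> h = g \<boxplus> h \<longleftrightarrow> f = g"
    and difference_exists: "g \<in> Mor C a b \<Longrightarrow> \<exists>u \<in> Mor C a b. f = u \<boxplus> g"
proof -
  interpret G: comm_group "Mor_group C a b"
    using f Mor_comm_group Mor_Obj by blast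
  have s: "carrier (Mor_group C a b) = Mor C a b" "one (Mor_group C a b) = Zero C a b"
    "mult (Mor_group C a b) = Add C"
    by (auto simp: Mor_group_def)
  show "Zero C a b \<boxplus> f = f" using f G.l_one s by metis
  show "f \<boxplus> g \<in> Mor C a b" if "g \<in> Mor C a b"
    using f that G.m_closed s by metis
  show "f \<boxplus> h = g \<boxplus> h \<longleftrightarrow> f = g" if "g \<in> Mor C a b" "h \<in> Mor C a b"
    using f that G.right_cancel s by metis
  show "\<exists>u \<in> Mor C a b. f = u \<boxplus> g" if g: "g \<in> Mor C a b"
  proof
    let ?i = "m_inv (Mor_group C a b) g"
    have i: "?i \<in> Mor C a b" using g G.inv_closed s by metis
    show "f \<boxplus> ?i \<in> Mor C a b" using f i G.m_closed s by metis
    show "f = f \<boxplus> ?i \<boxplus> g" using f g i G.m_assoc G.l_inv G.r_one s by metis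
  qed
qed

lemma Zero_in_Mor: "\<lbrakk>a \<in> Obj C; b \<in> Obj C\<rbrakk> \<Longrightarrow> Zero C a b \<in> Mor C a b"
  using Mor_comm_group[of a b, THEN comm_group.axioms(2), THEN group.is_monoid, THEN monoid.one_closed]
  by (simp add: Mor_group_def)

lemma Cmp_Zero:
  assumes "h \<in> Mor C b c" "a \<in> Obj C"
  shows "h \<cdot> Zero C a b = Zero C a c"
proof -
  have z: "Zero C a b \<in> Mor C a b" "Zero C a c \<in> Mor C a c"
    using assms Zero_in_Mor Mor_Obj by blast+
  have hz: "h \<cdot> Zero C a b \<in> Mor C a c" using Cmp_in_Mor[OF z(1) assms(1)] .
  \<comment> \<open>The composite is its own double, by distributivity over 0 + 0 = 0; cancelling
    one copy leaves zero.\<close>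
  have "h \<cdot> Zero C a b \<boxplus> h \<cdot> Zero C a b = Zero C a c \<boxplus> h \<cdot> Zero C a b"
    using Cmp_Add[OF z(1) z(1) assms(1)] Zero_Add[OF z(1)] Zero_Add[OF hz] by simp
  then show ?thesis using Add_right_cancel[OF hz z(2) hz] by simp
qed

lemma Zero_Cmp:
  assumes "h \<in> Mor C a b" "c \<in> Obj C"
  shows "Zero C b c \<cdot> h = Zero C a c"
proof -
  have z: "Zero C b c \<in> Mor C b c" "Zero C a c \<in> Mor C a c"
    using assms Zero_in_Mor Mor_Obj by blast+
  have hz: "Zero C b c \<cdot> h \<in> Mor C a c" using Cmp_in_Mor[OF assms(1) z(1)] .
  have "Zero C b c \<cdot> h \<boxplus> Zero C b c \<cdot> h = Zero C a c \<boxplus> Zero C b c \<cdot> h"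
    using Add_Cmp[OF assms(1) z(1) z(1)] Zero_Add[OF z(1)] Zero_Add[OF hz] by simp
  then show ?thesis using Add_right_cancel[OF hz z(2) hz] by simp
qed

text \<open>The difference \<open>u\<close> of \<open>x\<close> and \<open>y\<close> is killed by
  \<open>m\<close>, hence zero.\<close>

lemma zero_kernel_imp_cancel:
  assumes m: "m \<in> Mor C b c"
    and ker: "\<And>x. \<lbrakk>x \<in> Mor C a b; m \<cdot> x = Zero C a c\<rbrakk> \<Longrightarrow> x = Zero C a b"
    and x: "x \<in> Mor C a b" and y: "y \<in> Mor C a b" and eq: "m \<cdot> x = m \<cdot> y"
  shows "x = y"
proof -
  obtain u where u: "u \<in> Mor C a b" "x = u \<boxplus> y"
    using difference_exists[OF x y] by blast
  have mu: "m \<cdot> u \<in> Mor C a c" and my: "m \<cdot> y \<in> Mor C a c"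
    using Cmp_in_Mor u(1) y m by blast+
  have z: "Zero C a c \<in> Mor C a c" using Zero_in_Mor Mor_Obj[OF mu] by blast
  have "m \<cdot> u \<boxplus> m \<cdot> y = Zero C a c \<boxplus> m \<cdot> y"
    using Cmp_Add[OF u(1) y m] eq u(2) Zero_Add[OF my] by simp
  then have "m \<cdot> u = Zero C a c" using Add_right_cancel[OF mu z my] by simp
  then have "u = Zero C a b" using ker u(1) by blast
  then show ?thesis using u(2) Zero_Add[OF y] by simp
qed

end

section \<open>Short exact sequences, admissible epics and admissible monics\<close>

context exact_category
begin

lemma E_Mor:
  assumes "(i, p) \<in> E"
  shows "\<exists>a b c. i \<in> Mor C a b \<and> p \<in> Mor C b c \<and> p \<cdot> i = Zero C a c"
  using E_kernel_cokernel[OF assms] unfolding kernel_cokernel_pair_def is_kernel_def by blast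

lemma E_Cmp:
  assumes "(i, p) \<in> E" "i \<in> Mor C a b" "p \<in> Mor C b c"
  shows "p \<cdot> i = Zero C a c"
  using E_Mor[OF assms(1)] assms(2,3) by (auto simp: Mor_def)

text \<open>\<open>is_kernel\<close> hides its objects behind an existential quantifier, but a
  morphism determines its source and target, so the universal property holds at the objects already
  named.\<close>

lemma E_kernel:
  assumes "(i, p) \<in> E" "i \<in> Mor C a b" "p \<in> Mor C b c"
    and "g \<in> Mor C X b" "p \<cdot> g = Zero C X c"
  shows "\<exists>!h. h \<in> Mor C X a \<and> i \<cdot> h = g"
proof -
  have "is_kernel C i p"
    using E_kernel_cokernel[OF assms(1)] by (simp add: kernel_cokernel_pair_def)
  then obtain a' b' c' where 1: "i \<in> Mor C a' b'" "p \<in> Mor C b' c'"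
    "\<forall>X. \<forall>g \<in> Mor C X b'. p \<cdot> g = Zero C X c' \<longrightarrow> (\<exists>!h. h \<in> Mor C X a' \<and> i \<cdot> h = g)"
    unfolding is_kernel_def by blast
  have "a' = a" "b' = b" "c' = c"
    using Mor_unique[OF 1(1) assms(2)] Mor_unique[OF 1(2) assms(3)] by auto
  then show ?thesis using 1(3) assms(4,5) by simp
qed

lemma E_cokernel:
  assumes "(i, p) \<in> E" "i \<in> Mor C a b" "p \<in> Mor C b c"
    and "g \<in> Mor C b X" "g \<cdot> i = Zero C a X"
  shows "\<exists>!h. h \<in> Mor C c X \<and> h \<cdot> p = g"
proof -
  have "is_cokernel C p i"
    using E_kernel_cokernel[OF assms(1)] by (simp add: kernel_cokernel_pair_def)
  then obtain a' b' c' where 1: "i \<in> Mor C a' b'" "p \<in> Mor C b' c'"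
    "\<forall>X. \<forall>g \<in> Mor C b' X. g \<cdot> i = Zero C a' X \<longrightarrow> (\<exists>!h. h \<in> Mor C c' X \<and> h \<cdot> p = g)"
    unfolding is_cokernel_def by blast
  have "a' = a" "b' = b" "c' = c"
    using Mor_unique[OF 1(1) assms(2)] Mor_unique[OF 1(2) assms(3)] by auto
  then show ?thesis using 1(3) assms(4,5) by simp
qed

lemma adm_epic_Mor: "adm_epic E p \<Longrightarrow> \<exists>a b. p \<in> Mor C a b"
  unfolding adm_epic_def by (blast dest: E_Mor)

lemma adm_monic_Mor: "adm_monic E p \<Longrightarrow> \<exists>a b. p \<in> Mor C a b"
  unfolding adm_monic_def by (blast dest: E_Mor)

text \<open>An admissible epic is a cokernel of some \<open>i\<close>. Since
  \<open>x \<cdot> p\<close> kills \<open>i\<close>, it factors uniquely through \<open>p\<close>,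
  and both \<open>x\<close> and \<open>y\<close> are such factors.\<close>

lemma adm_epic_cancel:
  assumes "adm_epic E p" "p \<in> Mor C a b" "x \<in> Mor C b c" "y \<in> Mor C b c" "x \<cdot> p = y \<cdot> p"
  shows "x = y"
proof -
  obtain i where E: "(i, p) \<in> E" using assms(1) by (auto simp: adm_epic_def)
  obtain k where i: "i \<in> Mor C k a"
    using E_Mor[OF E] Mor_unique[OF assms(2)] by blast
  have "k \<in> Obj C" using Mor_Obj i by blast
  then have "(x \<cdot> p) \<cdot> i = Zero C k c"
    using Cmp_assoc[OF i assms(2,3)] Cmp_Zero[OF assms(3)] E_Cmp[OF E i assms(2)] by simp
  then have "\<exists>!h. h \<in> Mor C b c \<and> h \<cdot> p = x \<cdot> p"
    using E_cokernel[OF E i assms(2) Cmp_in_Mor[OF assms(2,3)]] by blast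
  then show ?thesis using assms(3-5) by metis
qed

text \<open>Both \<open>x\<close> and \<open>Zero C c a\<close> lift \<open>Zero C c b\<close> along
  the kernel \<open>m\<close>, and such a lift is unique.\<close>

lemma adm_monic_Cmp_eq_Zero:
  assumes "adm_monic E m" "m \<in> Mor C a b" "x \<in> Mor C c a" "m \<cdot> x = Zero C c b"
  shows "x = Zero C c a"
proof -
  obtain p where E: "(m, p) \<in> E" using assms(1) by (auto simp: adm_monic_def)
  obtain d where p: "p \<in> Mor C b d"
    using E_Mor[OF E] Mor_unique[OF assms(2)] by blast
  have o: "a \<in> Obj C" "b \<in> Obj C" "c \<in> Obj C" using Mor_Obj assms(2,3) by blast+
  have "\<exists>!h. h \<in> Mor C c a \<and> m \<cdot> h = Zero C c b"
    using E_kernel[OF E assms(2) p Zero_in_Mor[OF o(3,2)]] Cmp_Zero[OF p o(3)] by blast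
  moreover have "m \<cdot> Zero C c a = Zero C c b" using Cmp_Zero assms(2) o by simp
  ultimately show ?thesis using assms(3,4) Zero_in_Mor o by metis
qed

lemma adm_factorizationE:
  assumes "adm_factorization C E f m e" "f \<in> Mor C a b"
  obtains i where "e \<in> Mor C a i" "m \<in> Mor C i b" "adm_epic E e" "adm_monic E m" "f = m \<cdot> e"
proof -
  have f: "adm_epic E e" "adm_monic E m" "Tgt C e = Src C m" "f = m \<cdot> e"
    using assms(1) by (auto simp: adm_factorization_def)
  obtain a' i i' b' where e: "e \<in> Mor C a' i" and m: "m \<in> Mor C i' b'"
    using f adm_epic_Mor adm_monic_Mor by blast
  have i': "i' = i" using f(3) e m MorD by metis
  then have "f \<in> Mor C a' b'" using e m f(4) Cmp_in_Mor by blast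
  then have "a' = a" "b' = b" using Mor_unique assms(2) by metis+
  then show ?thesis using that e m f i' by blast
qed

text \<open>The form in which the pull-back axiom enters the chase: \<open>f\<close> lifts along
  \<open>p\<close> after precomposition with an admissible epic \<open>p'\<close>.\<close>

lemma adm_epic_pullback_square:
  assumes "adm_epic E p" "p \<in> Mor C b a" "f \<in> Mor C a' a"
  obtains b' p' f' where "adm_epic E p'" "p' \<in> Mor C b' a'" "f' \<in> Mor C b' b"
    "p \<cdot> f' = f \<cdot> p'"
proof -
  have "\<exists>p' f'. is_pullback C p f p' f' \<and> adm_epic E p'"
    using adm_epic_pullback[OF assms(1), of f] MorD[OF assms(2)] MorD[OF assms(3)] by auto
  then obtain p' f' where p': "is_pullback C p f p' f'" "adm_epic E p'" by blast
  then obtain A B A' B' where *: "p \<in> Mor C B A" "f \<in> Mor C A' A" "p' \<in> Mor C B' A'"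
    "f' \<in> Mor C B' B" "p \<cdot> f' = f \<cdot> p'"
    unfolding is_pullback_def by blast
  have "B = b" "A' = a'" using Mor_unique *(1,2) assms(2,3) by metis+
  then show ?thesis using that p'(2) * by blast
qed

section \<open>Exact pairs and a criterion for isomorphisms\<close>

lemma exact_pair_Cmp:
  assumes "exact_pair C E f g" "f \<in> Mor C a b" "g \<in> Mor C b c"
  shows "g \<cdot> f = Zero C a c"
proof -
  obtain m e m' e' where F: "adm_factorization C E f m e" "adm_factorization C E g m' e'"
    and E: "(m, e') \<in> E"
    using assms(1) by (auto simp: exact_pair_def)
  obtain i where i: "e \<in> Mor C a i" "m \<in> Mor C i b" "f = m \<cdot> e"
    using adm_factorizationE[OF F(1) assms(2)] by blast
  obtain j where j: "e' \<in> Mor C b j" "m' \<in> Mor C j c" "g = m' \<cdot> e'"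
    using adm_factorizationE[OF F(2) assms(3)] by blast
  have z: "e' \<cdot> m = Zero C i j"
    using E_Cmp[OF E i(2) j(1)] .
  have "g \<cdot> f = m' \<cdot> (e' \<cdot> (m \<cdot> e))"
    using Cmp_assoc[OF Cmp_in_Mor[OF i(1,2)] j(1,2)] i(3) j(3) by simp
  also have "e' \<cdot> (m \<cdot> e) = Zero C a j"
    using Cmp_assoc[OF i(1,2) j(1)] z Zero_Cmp[OF i(1)] Mor_Obj[OF j(1)] by simp
  finally show ?thesis using Cmp_Zero[OF j(2)] Mor_Obj[OF i(1)] by simp
qed

text \<open>This replaces the choice of a preimage of an element. As \<open>m'\<close> is monic,
  \<open>e'\<close> already kills \<open>x\<close>, so \<open>x\<close> factors through the kernel
  \<open>m\<close> of \<open>e'\<close>; lifting further along the epic part \<open>e\<close> costs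
  the precomposition with \<open>q\<close>.\<close>

lemma exact_pair_lift:
  assumes "exact_pair C E f g" "f \<in> Mor C a b" "g \<in> Mor C b c"
    and x: "x \<in> Mor C X b" "g \<cdot> x = Zero C X c"
  obtains Y q y where "adm_epic E q" "q \<in> Mor C Y X" "y \<in> Mor C Y a" "x \<cdot> q = f \<cdot> y"
proof -
  obtain m e m' e' where F: "adm_factorization C E f m e" "adm_factorization C E g m' e'"
    and E: "(m, e') \<in> E"
    using assms(1) by (auto simp: exact_pair_def)
  obtain i where i: "e \<in> Mor C a i" "m \<in> Mor C i b" "f = m \<cdot> e" "adm_epic E e"
    using adm_factorizationE[OF F(1) assms(2)] by blast
  obtain j where j: "e' \<in> Mor C b j" "m' \<in> Mor C j c" "g = m' \<cdot> e'" "adm_monic E m'"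
    using adm_factorizationE[OF F(2) assms(3)] by blast
  have "m' \<cdot> (e' \<cdot> x) = Zero C X c"
    using Cmp_assoc[OF x(1) j(1,2)] j(3) x(2) by simp
  then have "e' \<cdot> x = Zero C X j"
    using adm_monic_Cmp_eq_Zero[OF j(4,2) Cmp_in_Mor[OF x(1) j(1)]] by blast
  then obtain v where v: "v \<in> Mor C X i" "m \<cdot> v = x"
    using E_kernel[OF E i(2) j(1) x(1)] by blast
  \<comment> \<open>Pulling back \<open>e\<close> along \<open>v\<close> gives \<open>q\<close>
    together with the lift \<open>y\<close> of \<open>v \<cdot> q\<close>.\<close>
  obtain Y q y where q: "adm_epic E q" "q \<in> Mor C Y X" "y \<in> Mor C Y a" "e \<cdot> y = v \<cdot> q"
    using adm_epic_pullback_square[OF i(4,1) v(1)] by blast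
  have "x \<cdot> q = f \<cdot> y"
    using Cmp_assoc[OF q(2) v(1) i(2)] Cmp_assoc[OF q(3) i(1,2)] v(2) i(3) q(4) by simp
  then show ?thesis using that q by blast
qed

text \<open>The inverse of \<open>f\<close> is obtained by descending \<open>t\<close> along the
  cokernel \<open>p\<close>. The premise \<open>ker\<close>, ranging over all sources, says that
  \<open>f\<close> is monic.\<close>

lemma is_isomorphism_if_adm_epic_factors:
  assumes f: "f \<in> Mor C a b"
    and ker: "\<And>X x. \<lbrakk>x \<in> Mor C X a; f \<cdot> x = Zero C X b\<rbrakk> \<Longrightarrow> x = Zero C X a"
    and p: "adm_epic E p" "p \<in> Mor C P b" and t: "t \<in> Mor C P a" "p = f \<cdot> t"
  shows "is_isomorphism C f"
proof -
  obtain i where E: "(i, p) \<in> E" using p(1) by (auto simp: adm_epic_def)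
  obtain k where i: "i \<in> Mor C k P"
    using E_Mor[OF E] Mor_unique[OF p(2)] by blast
  \<comment> \<open>\<open>t\<close> descends along \<open>p\<close> once it kills \<open>i\<close>;
    this holds because \<open>p = f \<cdot> t\<close> kills \<open>i\<close> and \<open>f\<close> is
    monic.\<close>
  have "f \<cdot> (t \<cdot> i) = Zero C k b"
    using Cmp_assoc[OF i t(1) f] t(2) E_Cmp[OF E i p(2)] by simp
  then have "t \<cdot> i = Zero C k a" using ker[OF Cmp_in_Mor[OF i t(1)]] by blast
  then obtain q where q: "q \<in> Mor C b a" "q \<cdot> p = t" using E_cokernel[OF E i p(2) t(1)] by blast
  have ob: "a \<in> Obj C" "b \<in> Obj C" using Mor_Obj f by blast+
  have fq: "f \<cdot> q \<in> Mor C b b" and qf: "q \<cdot> f \<in> Mor C a a" using Cmp_in_Mor f q(1) by blast+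
  have "(f \<cdot> q) \<cdot> p = Idm C b \<cdot> p"
    using Cmp_assoc[OF p(2) q(1) f] q(2) t(2) Idm_Cmp[OF p(2)] by simp
  then have 1: "f \<cdot> q = Idm C b"
    using adm_epic_cancel[OF p fq Idm_in_Mor[OF ob(2)]] by blast
  \<comment> \<open>A right inverse of a monic is also a left inverse.\<close>
  have "f \<cdot> (q \<cdot> f) = f \<cdot> Idm C a"
    using Cmp_assoc[OF f q(1) f] 1 Idm_Cmp[OF f] Cmp_Idm[OF f] by simp
  then have 2: "q \<cdot> f = Idm C a"
    using zero_kernel_imp_cancel[OF f ker qf Idm_in_Mor[OF ob(1)]] by blast
  show ?thesis unfolding is_isomorphism_def using MorD[OF f] q(1) 1 2 by auto
qed

section \<open>The two diagram chases\<close>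

text \<open>Up to admissible epics, \<open>x\<close> comes from some \<open>y\<close> in
  \<open>A2\<close>; the image of \<open>y\<close> in \<open>B2\<close> comes from
  \<open>B1\<close>, so \<open>y\<close> comes from \<open>A1\<close> and is killed by
  \<open>a2\<close>. Hence \<open>x\<close> vanishes after precomposition with admissible epics,
  which can be cancelled.\<close>

lemma five_lemma_monic:
  assumes a: "a1 \<in> Mor C A1 A2" "a2 \<in> Mor C A2 A3" "a3 \<in> Mor C A3 A4"
    and b: "b1 \<in> Mor C B1 B2" "b2 \<in> Mor C B2 B3" "b3 \<in> Mor C B3 B4"
    and f: "f1 \<in> Mor C A1 B1" "f2 \<in> Mor C A2 B2" "f \<in> Mor C A3 B3" "f4 \<in> Mor C A4 B4"
    and sq: "f2 \<cdot> a1 = b1 \<cdot> f1" "f \<cdot> a2 = b2 \<cdot> f2" "f4 \<cdot> a3 = b3 \<cdot> f"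
    and ex: "exact_pair C E a1 a2" "exact_pair C E a2 a3" "exact_pair C E b1 b2"
    and iso: "is_isomorphism C f1" "is_isomorphism C f2" "is_isomorphism C f4"
    and x: "x \<in> Mor C X A3" "f \<cdot> x = Zero C X B3"
  shows "x = Zero C X A3"
proof -
  obtain g1 where g1: "g1 \<in> Mor C B1 A1" "f1 \<cdot> g1 = Idm C B1"
    using is_isomorphismE[OF iso(1) f(1)] by blast
  obtain g2 where g2: "g2 \<in> Mor C B2 A2" "g2 \<cdot> f2 = Idm C A2"
    using is_isomorphismE[OF iso(2) f(2)] by blast
  obtain g4 where g4: "g4 \<in> Mor C B4 A4" "g4 \<cdot> f4 = Idm C A4"
    using is_isomorphismE[OF iso(3) f(4)] by blast
  have X: "X \<in> Obj C" using Mor_Obj x(1) by blast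
  have a3x: "a3 \<cdot> x \<in> Mor C X A4" using Cmp_in_Mor x(1) a(3) by blast
  \<comment> \<open>By commutativity \<open>f4 \<cdot> a3\<close> kills \<open>x\<close>, and
    \<open>f4\<close> has a left inverse.\<close>
  have "f4 \<cdot> (a3 \<cdot> x) = Zero C X B4"
    using Cmp_assoc[OF x(1) a(3) f(4)] sq(3) Cmp_assoc[OF x(1) f(3) b(3)] x(2) Cmp_Zero[OF b(3) X]
    by simp
  then have "a3 \<cdot> x = Zero C X A4"
    using Cmp_left_inverse[OF g4(2) f(4) g4(1) a3x] Cmp_Zero[OF g4(1) X] by simp
  then obtain Y q y where q: "adm_epic E q" "q \<in> Mor C Y X" "y \<in> Mor C Y A2" "x \<cdot> q = a2 \<cdot> y"
    using exact_pair_lift[OF ex(2) a(2,3) x(1)] by blast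
  have f2y: "f2 \<cdot> y \<in> Mor C Y B2" using Cmp_in_Mor q(3) f(2) by blast
  have "b2 \<cdot> (f2 \<cdot> y) = f \<cdot> (x \<cdot> q)"
    using Cmp_assoc[OF q(3) f(2) b(2)] Cmp_assoc[OF q(3) a(2) f(3)] sq(2) q(4) by simp
  also have "\<dots> = Zero C Y B3"
    using Cmp_assoc[OF q(2) x(1) f(3)] x(2) Zero_Cmp[OF q(2)] Mor_Obj[OF f(3)] by simp
  finally obtain Z r z where r: "adm_epic E r" "r \<in> Mor C Z Y" "z \<in> Mor C Z B1"
    "(f2 \<cdot> y) \<cdot> r = b1 \<cdot> z"
    using exact_pair_lift[OF ex(3) b(1,2) f2y] by blast
  \<comment> \<open>\<open>w\<close> carries the lift \<open>z\<close> back from \<open>B1\<close>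
    to \<open>A1\<close>.\<close>
  define w where "w = g1 \<cdot> z"
  have w: "w \<in> Mor C Z A1" unfolding w_def using Cmp_in_Mor r(3) g1(1) by blast
  have z: "f1 \<cdot> w = z" unfolding w_def
    using Cmp_left_inverse[OF g1(2) g1(1) f(1) r(3)] .
  have yr: "y \<cdot> r \<in> Mor C Z A2" and aw: "a1 \<cdot> w \<in> Mor C Z A2"
    using Cmp_in_Mor r(2) q(3) w a(1) by blast+
  have "f2 \<cdot> (y \<cdot> r) = f2 \<cdot> (a1 \<cdot> w)"
    using Cmp_assoc[OF r(2) q(3) f(2)] r(4) z Cmp_assoc[OF w f(1) b(1)] Cmp_assoc[OF w a(1) f(2)]
      sq(1) by simp
  then have "y \<cdot> r = a1 \<cdot> w"
    using Cmp_left_inverse[OF g2(2) f(2) g2(1)] yr aw by metis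
  then have "a2 \<cdot> (y \<cdot> r) = Zero C Z A3"
    using Cmp_assoc[OF w a(1,2)] exact_pair_Cmp[OF ex(1) a(1,2)] Zero_Cmp[OF w] Mor_Obj[OF a(2)]
    by simp
  \<comment> \<open>The two epics are now cancelled in turn, first \<open>r\<close> and then
    \<open>q\<close>.\<close>
  then have "(x \<cdot> q) \<cdot> r = Zero C Y A3 \<cdot> r"
    using Cmp_assoc[OF r(2) q(3) a(2)] q(4) Zero_Cmp[OF r(2)] Mor_Obj[OF a(2)] by simp
  then have "x \<cdot> q = Zero C Y A3"
    using adm_epic_cancel[OF r(1,2) Cmp_in_Mor[OF q(2) x(1)]] Zero_in_Mor Mor_Obj[OF q(2)] Mor_Obj[OF a(2)]
    by blast
  then have "x \<cdot> q = Zero C X A3 \<cdot> q" using Zero_Cmp[OF q(2)] Mor_Obj[OF a(2)] by simp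
  then show ?thesis
    using adm_epic_cancel[OF q(1,2) x(1)] Zero_in_Mor[OF X] Mor_Obj[OF a(2)] by blast
qed

text \<open>A detour through \<open>A4\<close> lifts the identity of \<open>B3\<close>, up to the
  epic \<open>q\<close>, to an approximate preimage \<open>y\<close>. Its error is killed by
  \<open>b3\<close>, hence comes from \<open>B2\<close> up to a further epic \<open>r\<close>, and
  is corrected by an element from \<open>A2\<close>. The resulting epic is
  \<open>q \<cdot> r\<close>.\<close>

lemma five_lemma_adm_epic_factors:
  assumes a: "a2 \<in> Mor C A2 A3" "a3 \<in> Mor C A3 A4" "a4 \<in> Mor C A4 A5"
    and b: "b2 \<in> Mor C B2 B3" "b3 \<in> Mor C B3 B4" "b4 \<in> Mor C B4 B5"
    and f: "f2 \<in> Mor C A2 B2" "f \<in> Mor C A3 B3" "f4 \<in> Mor C A4 B4" "f5 \<in> Mor C A5 B5"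
    and sq: "f \<cdot> a2 = b2 \<cdot> f2" "f4 \<cdot> a3 = b3 \<cdot> f" "f5 \<cdot> a4 = b4 \<cdot> f4"
    and ex: "exact_pair C E a3 a4" "exact_pair C E b2 b3" "exact_pair C E b3 b4"
    and iso: "is_isomorphism C f2" "is_isomorphism C f4" "is_isomorphism C f5"
  obtains P p t where "adm_epic E p" "p \<in> Mor C P B3" "t \<in> Mor C P A3" "p = f \<cdot> t"
proof -
  obtain g2 where g2: "g2 \<in> Mor C B2 A2" "f2 \<cdot> g2 = Idm C B2"
    using is_isomorphismE[OF iso(1) f(1)] by blast
  obtain g4 where g4: "g4 \<in> Mor C B4 A4" "f4 \<cdot> g4 = Idm C B4"
    using is_isomorphismE[OF iso(2) f(3)] by blast
  obtain g5 where g5: "g5 \<in> Mor C B5 A5" "g5 \<cdot> f5 = Idm C A5"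
    using is_isomorphismE[OF iso(3) f(4)] by blast
  \<comment> \<open>\<open>w\<close> is the preimage under \<open>f4\<close> of the identity of
    \<open>B3\<close> pushed forward by \<open>b3\<close>.\<close>
  define w where "w = g4 \<cdot> b3"
  have w: "w \<in> Mor C B3 A4" unfolding w_def using Cmp_in_Mor b(2) g4(1) by blast
  have f4w: "f4 \<cdot> w = b3" unfolding w_def
    using Cmp_left_inverse[OF g4(2) g4(1) f(3) b(2)] .
  have B3: "B3 \<in> Obj C" using Mor_Obj b(2) by blast
  have a4w: "a4 \<cdot> w \<in> Mor C B3 A5" using Cmp_in_Mor w a(3) by blast
  have "f5 \<cdot> (a4 \<cdot> w) = Zero C B3 B5"
    using Cmp_assoc[OF w a(3) f(4)] sq(3) Cmp_assoc[OF w f(3) b(3)] f4w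
      exact_pair_Cmp[OF ex(3) b(2,3)] by simp
  then have "a4 \<cdot> w = Zero C B3 A5"
    using Cmp_left_inverse[OF g5(2) f(4) g5(1) a4w] Cmp_Zero[OF g5(1) B3] by simp
  then obtain Y q y where q: "adm_epic E q" "q \<in> Mor C Y B3" "y \<in> Mor C Y A3" "w \<cdot> q = a3 \<cdot> y"
    using exact_pair_lift[OF ex(1) a(2,3) w] by blast
  have fy: "f \<cdot> y \<in> Mor C Y B3" using Cmp_in_Mor q(3) f(2) by blast
  \<comment> \<open>\<open>u\<close> is the error of \<open>f \<cdot> y\<close> as an approximation
    of \<open>q\<close>; both have the same image under \<open>b3\<close>.\<close>
  obtain u where u: "u \<in> Mor C Y B3" "q = u \<boxplus> f \<cdot> y"
    using difference_exists[OF q(2) fy] by blast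
  have b3u: "b3 \<cdot> u \<in> Mor C Y B4" and b3q: "b3 \<cdot> q \<in> Mor C Y B4"
    using Cmp_in_Mor u(1) q(2) b(2) by blast+
  have z: "Zero C Y B4 \<in> Mor C Y B4" using Zero_in_Mor Mor_Obj[OF b3u] by blast
  have "b3 \<cdot> (f \<cdot> y) = b3 \<cdot> q"
    using Cmp_assoc[OF q(3) f(2) b(2)] sq(2) Cmp_assoc[OF q(3) a(2) f(3)] q(4)
      Cmp_assoc[OF q(2) w f(3)] f4w by simp
  \<comment> \<open>Apply \<open>b3\<close> to \<open>q = u \<boxplus> f \<cdot> y\<close> and
    replace \<open>b3 \<cdot> (f \<cdot> y)\<close> by \<open>b3 \<cdot> q\<close>.\<close>
  then have "b3 \<cdot> u \<boxplus> b3 \<cdot> q = Zero C Y B4 \<boxplus> b3 \<cdot> q"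
    using Cmp_Add[OF u(1) fy b(2)] u(2) Zero_Add[OF b3q] by simp
  then have "b3 \<cdot> u = Zero C Y B4" using Add_right_cancel[OF b3u z b3q] by simp
  then obtain Z r v where r: "adm_epic E r" "r \<in> Mor C Z Y" "v \<in> Mor C Z B2" "u \<cdot> r = b2 \<cdot> v"
    using exact_pair_lift[OF ex(2) b(1,2) u(1)] by blast
  have g2v: "g2 \<cdot> v \<in> Mor C Z A2" using Cmp_in_Mor r(3) g2(1) by blast
  \<comment> \<open>\<open>s\<close> carries \<open>v\<close> back along \<open>f2\<close> and on to
    \<open>A3\<close>, so that \<open>f\<close> maps it to the error
    \<open>u \<cdot> r\<close>.\<close>
  define s where "s = a2 \<cdot> (g2 \<cdot> v)"
  have s: "s \<in> Mor C Z A3" unfolding s_def using Cmp_in_Mor g2v a(1) by blast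
  have fs: "f \<cdot> s = u \<cdot> r" unfolding s_def
    using Cmp_assoc[OF g2v a(1) f(2)] sq(1) Cmp_assoc[OF g2v f(1) b(1)]
      Cmp_left_inverse[OF g2(2) g2(1) f(1) r(3)] r(4) by simp
  have yr: "y \<cdot> r \<in> Mor C Z A3" using Cmp_in_Mor r(2) q(3) by blast
  \<comment> \<open>Adding the correction \<open>s\<close> to \<open>y \<cdot> r\<close> makes the
    lift exact.\<close>
  have "q \<cdot> r = f \<cdot> (s \<boxplus> y \<cdot> r)"
    using u(2) Add_Cmp[OF r(2) u(1) fy] Cmp_assoc[OF r(2) q(3) f(2)] fs Cmp_Add[OF s yr f(2)]
    by simp
  moreover have "adm_epic E (q \<cdot> r)"
    using adm_epic_Cmp[OF r(1) q(1)] MorD[OF r(2)] MorD[OF q(2)] by simp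
  moreover have "q \<cdot> r \<in> Mor C Z B3" using Cmp_in_Mor r(2) q(2) by blast
  ultimately show ?thesis using that Add_in_Mor[OF s yr] by blast
qed

end

theorem lemma8p9:
  fixes C :: "('o, 'm) preaddcat" (structure)
    and E :: "('m \<times> 'm) set"
  assumes "exact_category C E"
    and "a1 \<in> Mor C A1 A2" and "a2 \<in> Mor C A2 A3" and "a3 \<in> Mor C A3 A4" and "a4 \<in> Mor C A4 A5"
    and "b1 \<in> Mor C B1 B2" and "b2 \<in> Mor C B2 B3" and "b3 \<in> Mor C B3 B4" and "b4 \<in> Mor C B4 B5"
    and "f1 \<in> Mor C A1 B1" and "f2 \<in> Mor C A2 B2" and "f \<in> Mor C A3 B3"
    and "f4 \<in> Mor C A4 B4" and "f5 \<in> Mor C A5 B5"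
    and "f2 \<cdot> a1 = b1 \<cdot> f1" and "f \<cdot> a2 = b2 \<cdot> f2"
    and "f4 \<cdot> a3 = b3 \<cdot> f" and "f5 \<cdot> a4 = b4 \<cdot> f4"
    and "exact_sequence C E [a1, a2, a3, a4]"
    and "exact_sequence C E [b1, b2, b3, b4]"
    and "is_isomorphism C f1" and "is_isomorphism C f2" and "is_isomorphism C f4" and "is_isomorphism C f5"
  shows "is_isomorphism C f"
proof -
  interpret exact_category C E by fact
  have a: "exact_pair C E a1 a2" "exact_pair C E a2 a3" "exact_pair C E a3 a4"
    and b: "exact_pair C E b1 b2" "exact_pair C E b2 b3" "exact_pair C E b3 b4"
    using assms(19,20) by (auto simp: exact_sequence_def)
  obtain P p t where "adm_epic E p" "p \<in> Mor C P B3" "t \<in> Mor C P A3" "p = f \<cdot> t"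
    using five_lemma_adm_epic_factors[OF assms(3-5,7-9,11-14,16-18) a(3) b(2,3) assms(22-24)] .
  \<comment> \<open>The first chase stays a rule with \<open>X\<close> and \<open>x\<close> free, so
    it discharges \<open>ker\<close> at every source.\<close>
  with is_isomorphism_if_adm_epic_factors[OF assms(12)]
    five_lemma_monic[OF assms(2-4,6-8,10-13,15-17) a(1,2) b(1) assms(21-23)]
  show ?thesis by blast
qed

end
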